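(* Let $\varphi$ be an edge precoloring of $Q_d$ with colors from $\{1,\dots,d\}$. If the precolored edges of $Q_d$ form an induced matching all edges of which lie in two dimensional matchings of $Q_d$, then $\varphi$ is extendable to a proper $d$-edge coloring of $Q_d$.
   Context: $Q_d$ is the $d$-dimensional hypercube graph. An edge precoloring is a proper edge coloring of some subset of the edges (adjacent colored edges get distinct colors); these edges are called precolored. A proper $d$-edge coloring is a proper edge coloring of all edges with colors from $\{1,\dots,d\}$. A precoloring $\varphi$ is extendable if there is a proper $d$-edge coloring $f$ of $Q_d$ with $f(e)=\varphi(e)$ for every edge $e$ colored under $\varphi$. The distance between two edges $e,e'$ is the number of edges in a shortest path between an endpoint of $e$ and an endpoint of $e'$. An induced matching is a matching in which any two distinct edges are at distance at least $2$ from each other. A dimensional matching of $Q_d$ is a perfect matching $M$ of $Q_d$ such that $Q_d - M$ (removing the edges of $M$) is isomorphic to two disjoint copies of $Q_{d-1}$; there are exactly $d$ of them. *)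

theory Defs
  imports Main "HOL-Library.Extended_Nat"
begin

text \<open>
  A simple graph is a pair \<open>(V, E)\<close> of a vertex set and a set of edges, each edge
  being a two-element set of vertices.
\<close>

type_synonym 'a graph = "'a set \<times> 'a set set"

abbreviation verts :: "'a graph \<Rightarrow> 'a set" where
  "verts G \<equiv> fst G"

abbreviation edges :: "'a graph \<Rightarrow> 'a set set" where
  "edges G \<equiv> snd G"

definition hypercube :: "nat \<Rightarrow> bool list graph" where
  "hypercube d =
     ({x. length x = d},
      {{x, y} | x y. length x = d \<and> length y = d \<and> card {i. i < d \<and> x ! i \<noteq> y ! i} = 1})"

definition graph_iso :: "'a graph \<Rightarrow> 'b graph \<Rightarrow> bool" where
  "graph_iso G H \<longleftrightarrow>
     (\<exists>f. bij_betw f (verts G) (verts H) \<and>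
          (\<forall>u\<in>verts G. \<forall>v\<in>verts G. {u, v} \<in> edges G \<longleftrightarrow> {f u, f v} \<in> edges H))"

definition disjoint_union :: "'a graph \<Rightarrow> 'b graph \<Rightarrow> ('a + 'b) graph" where
  "disjoint_union G H =
     (Inl ` verts G \<union> Inr ` verts H, image Inl ` edges G \<union> image Inr ` edges H)"

definition delete_edges :: "'a graph \<Rightarrow> 'a set set \<Rightarrow> 'a graph" where
  "delete_edges G M = (verts G, edges G - M)"

definition matching :: "'a graph \<Rightarrow> 'a set set \<Rightarrow> bool" where
  "matching G M \<longleftrightarrow> M \<subseteq> edges G \<and> (\<forall>e\<in>M. \<forall>e'\<in>M. e \<noteq> e' \<longrightarrow> e \<inter> e' = {})"

definition perfect_matching :: "'a graph \<Rightarrow> 'a set set \<Rightarrow> bool" where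
  "perfect_matching G M \<longleftrightarrow> matching G M \<and> \<Union>M = verts G"

text \<open>
  For \<open>d = 0\<close> the truncated \<open>d - 1\<close> is harmless: the one-vertex graph has no perfect
  matching, so there is no dimensional matching.
\<close>

definition dimensional_matching :: "nat \<Rightarrow> bool list set set \<Rightarrow> bool" where
  "dimensional_matching d M \<longleftrightarrow>
     perfect_matching (hypercube d) M \<and>
     graph_iso (delete_edges (hypercube d) M)
       (disjoint_union (hypercube (d - 1)) (hypercube (d - 1)))"

definition path_between :: "'a graph \<Rightarrow> 'a \<Rightarrow> 'a list \<Rightarrow> 'a \<Rightarrow> bool" where
  "path_between G u p v \<longleftrightarrow>
     p \<noteq> [] \<and> hd p = u \<and> last p = v \<and> distinct p \<and> set p \<subseteq> verts G \<and>
     (\<forall>i. Suc i < length p \<longrightarrow> {p ! i, p ! Suc i} \<in> edges G)"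

text \<open>
  A path with vertex list \<open>p\<close> has \<open>length p - 1\<close> edges; the distance is \<open>\<infinity>\<close> if no path
  joins the two edges, and \<open>0\<close> if they share an endpoint.
\<close>

definition edge_dist :: "'a graph \<Rightarrow> 'a set \<Rightarrow> 'a set \<Rightarrow> enat" where
  "edge_dist G e e' =
     Inf {enat (length p - 1) | p. \<exists>u\<in>e. \<exists>v\<in>e'. path_between G u p v}"

definition induced_matching :: "'a graph \<Rightarrow> 'a set set \<Rightarrow> bool" where
  "induced_matching G M \<longleftrightarrow>
     matching G M \<and> (\<forall>e\<in>M. \<forall>e'\<in>M. e \<noteq> e' \<longrightarrow> edge_dist G e e' \<ge> 2)"

text \<open>A precoloring is a partial map on edges; its domain is the set of precolored edges.\<close>

definition edge_precoloring :: "'a graph \<Rightarrow> ('a set \<rightharpoonup> nat) \<Rightarrow> bool" where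
  "edge_precoloring G \<phi> \<longleftrightarrow>
     dom \<phi> \<subseteq> edges G \<and>
     (\<forall>e\<in>dom \<phi>. \<forall>e'\<in>dom \<phi>. e \<noteq> e' \<and> e \<inter> e' \<noteq> {} \<longrightarrow> \<phi> e \<noteq> \<phi> e')"

definition proper_edge_coloring :: "'a graph \<Rightarrow> nat \<Rightarrow> ('a set \<Rightarrow> nat) \<Rightarrow> bool" where
  "proper_edge_coloring G k f \<longleftrightarrow>
     f ` edges G \<subseteq> {1..k} \<and>
     (\<forall>e\<in>edges G. \<forall>e'\<in>edges G. e \<noteq> e' \<and> e \<inter> e' \<noteq> {} \<longrightarrow> f e \<noteq> f e')"

definition extendable :: "nat \<Rightarrow> (bool list set \<rightharpoonup> nat) \<Rightarrow> bool" where
  "extendable d \<phi> \<longleftrightarrow>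
     (\<exists>f. proper_edge_coloring (hypercube d) d f \<and> (\<forall>e\<in>dom \<phi>. \<phi> e = Some (f e)))"

end

theory Submission imports Defs begin

text \<open>
  A dimensional matching is the set of all edges in one direction
  (\<open>dimensional_matching_direction\<close>), so the precolored edges use at most two directions
  \<open>i \<noteq> j\<close>. Splitting off these directions gives \<open>Q\<^sub>d = Q\<^sub>d\<^sub>-\<^sub>2 \<times> C\<^sub>4\<close>: a fibre is a 4-cycle on
  the directions \<open>i\<close> and \<open>j\<close>, and any two edges of a 4-cycle are at distance at most 1.
  Hence each fibre \<open>z\<close> contains at most one precolored edge; let \<open>\<psi> z\<close> be its color, or an
  arbitrary color if there is none.

  It now suffices to color \<open>Q\<^sub>d\<^sub>-\<^sub>2\<close> with \<open>d\<close> colors such that no edge at \<open>z\<close> has the color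
  \<open>\<psi> z\<close>. Using this coloring in all four copies of \<open>Q\<^sub>d\<^sub>-\<^sub>2\<close> leaves two colors free at all
  vertices of the fibre over \<open>z\<close>, one of which is \<open>\<psi> z\<close>. The 4-cycle is colored
  alternately with these two, and \<open>\<psi> z\<close> goes to the direction of the precolored edge.

  In \<open>Q\<^sub>d\<^sub>-\<^sub>2\<close> an edge \<open>z w\<close> may have any color except \<open>\<psi> z\<close> and \<open>\<psi> w\<close>, which leaves at least
  \<open>d - 2\<close> choices, as many as the maximum degree. The coloring therefore exists by Galvin's
  theorem on list edge colorings of bipartite graphs (\<open>bipartite_list_edge_coloring\<close>).
\<close>

section \<open>List edge colorings of bipartite graphs\<close>

text \<open>
  A bipartite multigraph is given by its set of edges and the maps \<open>p\<close> and \<open>q\<close> that send an edge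
  to its endpoint on either side; \<open>c\<close> is a proper edge coloring, used as a ranking. The two
  sides rank in opposite order: \<open>p\<close>-vertices prefer high colors and \<open>q\<close>-vertices low ones.
  This is the orientation of the line graph in Galvin's proof.
\<close>

definition beats :: "('e \<Rightarrow> 'a) \<Rightarrow> ('e \<Rightarrow> 'b) \<Rightarrow> ('e \<Rightarrow> nat) \<Rightarrow> 'e \<Rightarrow> 'e \<Rightarrow> bool" where
  "beats p q c f e \<longleftrightarrow> p f = p e \<and> c e < c f \<or> q f = q e \<and> c f < c e"

text \<open>
  This is the stable matching theorem: \<open>K\<close> is a kernel of the oriented line graph. Let every
  \<open>p\<close>-vertex choose its favorite edge. If the chosen edges form a matching, they are a kernel.
  Otherwise two of them, \<open>e\<close> and \<open>f\<close>, meet in a \<open>q\<close>-vertex that prefers \<open>e\<close>. A kernel of the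
  graph without \<open>f\<close> still works: it contains \<open>e\<close> or an edge beating \<open>e\<close>, and as \<open>e\<close> is a
  favorite on its \<open>p\<close>-side, the latter edge beats \<open>e\<close>, and hence also \<open>f\<close>, at the \<open>q\<close>-vertex.
\<close>

lemma stable_matching_exists:
  fixes p :: "'e \<Rightarrow> 'a" and q :: "'e \<Rightarrow> 'b" and c :: "'e \<Rightarrow> nat"
  assumes "finite E"
    and "\<And>e f. e \<in> E \<Longrightarrow> f \<in> E \<Longrightarrow> e \<noteq> f \<Longrightarrow> p e = p f \<or> q e = q f \<Longrightarrow> c e \<noteq> c f"
  shows "\<exists>K\<subseteq>E. (\<forall>e\<in>K. \<forall>f\<in>K. e \<noteq> f \<longrightarrow> p e \<noteq> p f \<and> q e \<noteq> q f) \<and>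
                (\<forall>e\<in>E - K. \<exists>f\<in>K. beats p q c f e)"
  using assms
proof (induction E rule: finite_psubset_induct)
  case (psubset E)
  define T where "T = {e \<in> E. \<forall>f\<in>E. p f = p e \<longrightarrow> c f \<le> c e}"
  show ?case
  proof (cases "\<exists>e\<in>T. \<exists>f\<in>T. e \<noteq> f \<and> q e = q f")
    case True
    then obtain a b where ab: "a \<in> T" "b \<in> T" "a \<noteq> b" "q a = q b" by blast
    then have "c a \<noteq> c b" using psubset.prems[of a b] by (simp add: T_def)
    then obtain e f where ef: "e \<in> T" "f \<in> T" "e \<noteq> f" "q e = q f" "c e < c f"
      using ab by (metis linorder_neqE_nat)
    have "E - {f} \<subset> E" using ef by (auto simp: T_def)
    then have "\<exists>K\<subseteq>E - {f}. (\<forall>e\<in>K. \<forall>f\<in>K. e \<noteq> f \<longrightarrow> p e \<noteq> p f \<and> q e \<noteq> q f) \<and>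
        (\<forall>e\<in>E - {f} - K. \<exists>f\<in>K. beats p q c f e)"
      by (rule psubset.IH) (use psubset.prems in blast)
    then obtain K where K: "K \<subseteq> E - {f}"
      "\<forall>e\<in>K. \<forall>f\<in>K. e \<noteq> f \<longrightarrow> p e \<noteq> p f \<and> q e \<noteq> q f"
      "\<forall>e\<in>E - {f} - K. \<exists>f\<in>K. beats p q c f e" by blast
    have "\<exists>g\<in>K. beats p q c g f"
    proof (cases "e \<in> K")
      case True
      then show ?thesis using ef by (auto simp: beats_def)
    next
      case False
      then have "e \<in> E - {f} - K" using ef by (auto simp: T_def)
      then obtain g where g: "g \<in> K" "beats p q c g e" using K(3) by blast
      have "\<not> (p g = p e \<and> c e < c g)" using ef(1) g(1) K(1) by (auto simp: T_def)
      then show ?thesis using g ef by (auto simp: beats_def intro!: bexI[of _ g])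
    qed
    then show ?thesis using K by (intro exI[of _ K]) blast
  next
    case False
    have "\<exists>f\<in>T. beats p q c f e" if e: "e \<in> E - T" for e
    proof -
      let ?S = "{f \<in> E. p f = p e}"
      have fin: "finite ?S" and ne: "?S \<noteq> {}" using psubset.hyps e by auto
      have "Max (c ` ?S) \<in> c ` ?S" using fin ne by (intro Max_in) auto
      then obtain f where f: "f \<in> ?S" "c f = Max (c ` ?S)" by auto
      have ub: "c g \<le> c f" if "g \<in> ?S" for g using that fin f(2) by auto
      have "f \<in> T" using f(1) ub by (auto simp: T_def)
      moreover obtain g where "g \<in> E" "p g = p e" "c e < c g" using e by (auto simp: T_def not_le)
      then have "c e < c f" using ub[of g] by auto
      ultimately show ?thesis using f(1) by (auto simp: beats_def)
    qed
    moreover have "p e \<noteq> p f" if "e \<in> T" "f \<in> T" "e \<noteq> f" for e f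
    proof
      assume "p e = p f"
      then have "c e = c f" using that(1,2) by (auto simp: T_def intro: antisym)
      then show False using that psubset.prems[of e f] \<open>p e = p f\<close> by (simp add: T_def)
    qed
    moreover have "T \<subseteq> E" by (auto simp: T_def)
    ultimately show ?thesis using False by (intro exI[of _ T]) blast
  qed
qed

text \<open>
  Pick a color \<open>a\<close> from some list and give it to a kernel of the edges whose lists contain it.
  Every other such edge loses \<open>a\<close> from its list, but also loses an edge that beats it, so the
  strict inequality between the two cardinalities survives for the remaining edges.
\<close>

lemma kernel_list_coloring:
  fixes p :: "'e \<Rightarrow> 'a" and q :: "'e \<Rightarrow> 'b" and c :: "'e \<Rightarrow> nat" and L :: "'e \<Rightarrow> 'c set"
  assumes "finite E"
    and "\<And>e f. e \<in> E \<Longrightarrow> f \<in> E \<Longrightarrow> e \<noteq> f \<Longrightarrow> p e = p f \<or> q e = q f \<Longrightarrow> c e \<noteq> c f"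
    and "\<And>e. e \<in> E \<Longrightarrow> card {f \<in> E. beats p q c f e} < card (L e)"
  shows "\<exists>g. (\<forall>e\<in>E. g e \<in> L e) \<and>
             (\<forall>e\<in>E. \<forall>f\<in>E. e \<noteq> f \<and> (p e = p f \<or> q e = q f) \<longrightarrow> g e \<noteq> g f)"
  using assms
proof (induction E arbitrary: L rule: finite_psubset_induct)
  case (psubset E)
  show ?case
  proof (cases "E = {}")
    case False
    then obtain e0 where e0: "e0 \<in> E" by auto
    then have "L e0 \<noteq> {}" using psubset.prems(2)[of e0] by auto
    then obtain a where a: "a \<in> L e0" by auto
    define A where "A = {e \<in> E. a \<in> L e}"
    have "finite A" "\<And>e f. e \<in> A \<Longrightarrow> f \<in> A \<Longrightarrow> e \<noteq> f \<Longrightarrow> p e = p f \<or> q e = q f \<Longrightarrow> c e \<noteq> c f"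
      using psubset.hyps psubset.prems(1) by (auto simp: A_def)
    from stable_matching_exists[where p = p and q = q and c = c, OF this] obtain K where K: "K \<subseteq> A"
      "\<forall>e\<in>K. \<forall>f\<in>K. e \<noteq> f \<longrightarrow> p e \<noteq> p f \<and> q e \<noteq> q f"
      "\<forall>e\<in>A - K. \<exists>f\<in>K. beats p q c f e" by blast
    have "e0 \<in> A" using e0 a by (auto simp: A_def)
    then have "K \<noteq> {}" using K(3) by blast
    then have sub: "E - K \<subset> E" using K(1) by (auto simp: A_def)
    have less: "card {f \<in> E - K. beats p q c f e} < card (L e - {a})" if e: "e \<in> E - K" for e
    proof (cases "a \<in> L e")
      case True
      then obtain f where f: "f \<in> K" "beats p q c f e" using K(3) e by (auto simp: A_def)
      then have "{f \<in> E - K. beats p q c f e} \<subset> {f \<in> E. beats p q c f e}"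
        using K(1) by (auto simp: A_def)
      then have "card {f \<in> E - K. beats p q c f e} < card {f \<in> E. beats p q c f e}"
        using psubset.hyps by (intro psubset_card_mono) auto
      moreover have "card {f \<in> E. beats p q c f e} < card (L e)" using psubset.prems(2) e by auto
      moreover have "card (L e - {a}) = card (L e) - 1" using True by (rule card_Diff_singleton)
      ultimately show ?thesis by linarith
    next
      case False
      have "card {f \<in> E - K. beats p q c f e} \<le> card {f \<in> E. beats p q c f e}"
        using psubset.hyps by (intro card_mono) auto
      also have "\<dots> < card (L e)" using psubset.prems(2) e by auto
      finally show ?thesis using False by simp
    qed
    have "\<exists>g. (\<forall>e\<in>E - K. g e \<in> L e - {a}) \<and>
             (\<forall>e\<in>E - K. \<forall>f\<in>E - K. e \<noteq> f \<and> (p e = p f \<or> q e = q f) \<longrightarrow> g e \<noteq> g f)"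
      by (rule psubset.IH[OF sub]) (use psubset.prems(1) less in auto)
    then obtain g where g: "\<forall>e\<in>E - K. g e \<in> L e - {a}"
      "\<forall>e\<in>E - K. \<forall>f\<in>E - K. e \<noteq> f \<and> (p e = p f \<or> q e = q f) \<longrightarrow> g e \<noteq> g f" by blast
    show ?thesis
    proof (intro exI conjI ballI impI)
      fix e assume "e \<in> E"
      then show "(if e \<in> K then a else g e) \<in> L e" using g(1) K(1) by (auto simp: A_def)
    next
      fix e f assume ef: "e \<in> E" "f \<in> E" "e \<noteq> f \<and> (p e = p f \<or> q e = q f)"
      then show "(if e \<in> K then a else g e) \<noteq> (if f \<in> K then a else g f)"
        using g K(2) by (cases "e \<in> K"; cases "f \<in> K") auto
    qed
  qed auto
qed

text \<open>
  Galvin's theorem. The edges beating \<open>e\<close> have distinct colors under \<open>c\<close>, since those at the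
  \<open>p\<close>-endpoint lie above \<open>c e\<close> and those at the \<open>q\<close>-endpoint below; none of them has the
  color \<open>c e\<close> itself. So there are fewer of them than colors in \<open>D\<close>.
\<close>

lemma bipartite_list_edge_coloring:
  fixes p :: "'e \<Rightarrow> 'a" and q :: "'e \<Rightarrow> 'b" and c :: "'e \<Rightarrow> nat" and L :: "'e \<Rightarrow> 'c set"
  assumes "finite E" and D: "finite D" "c ` E \<subseteq> D"
    and proper: "\<And>e f. e \<in> E \<Longrightarrow> f \<in> E \<Longrightarrow> e \<noteq> f \<Longrightarrow> p e = p f \<or> q e = q f \<Longrightarrow> c e \<noteq> c f"
    and lists: "\<And>e. e \<in> E \<Longrightarrow> card D \<le> card (L e)"
  shows "\<exists>g. (\<forall>e\<in>E. g e \<in> L e) \<and>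
             (\<forall>e\<in>E. \<forall>f\<in>E. e \<noteq> f \<and> (p e = p f \<or> q e = q f) \<longrightarrow> g e \<noteq> g f)"
proof (rule kernel_list_coloring[OF \<open>finite E\<close> proper])
  fix e assume e: "e \<in> E"
  let ?B = "{f \<in> E. beats p q c f e}"
  have "inj_on c ?B"
  proof (rule inj_onI)
    fix f g assume fg: "f \<in> ?B" "g \<in> ?B" "c f = c g"
    then have "p f = p g \<or> q f = q g" by (auto simp: beats_def)
    then show "f = g" using proper[of f g] fg by auto
  qed
  moreover have "c ` ?B \<subseteq> D - {c e}" using D(2) by (auto simp: beats_def)
  ultimately have "card ?B \<le> card (D - {c e})" using D(1) by (intro card_inj_on_le) auto
  also have "\<dots> < card D" using D e by (intro card_Diff1_less) auto
  finally show "card ?B < card (L e)" using lists[OF e] by linarith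
qed

section \<open>Directions in the hypercube\<close>

definition flip :: "bool list \<Rightarrow> nat \<Rightarrow> bool list" where
  "flip x k = x[k := \<not> x ! k]"

lemma length_flip [simp]: "length (flip x k) = length x"
  by (simp add: flip_def)

lemma nth_flip: "k < length x \<Longrightarrow> flip x k ! l = (if l = k then \<not> x ! k else x ! l)"
  by (simp add: flip_def nth_list_update)

lemma flip_flip [simp]: "k < length x \<Longrightarrow> flip (flip x k) k = x"
  by (simp add: flip_def)

lemma flip_commute: "flip (flip x k) l = flip (flip x l) k"
  by (cases "k = l") (auto simp: flip_def list_update_swap)

lemma flip_inject: "k < length x \<Longrightarrow> l < length x \<Longrightarrow> flip x k = flip x l \<longleftrightarrow> k = l"
  by (metis nth_flip)

lemma flip_neq [simp]: "k < length x \<Longrightarrow> flip x k \<noteq> x"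
  by (metis nth_flip)

definition edge :: "bool list \<Rightarrow> nat \<Rightarrow> bool list set" where
  "edge x k = {x, flip x k}"

lemma edge_flip: "k < length x \<Longrightarrow> edge (flip x k) k = edge x k"
  by (auto simp: edge_def)

lemma edge_eq_iff:
  assumes "length x = d" "length y = d" "k < d" "l < d"
  shows "edge x k = edge y l \<longleftrightarrow> k = l \<and> (y = x \<or> y = flip x k)"
proof -
  have "x = flip y l \<and> flip x k = y \<longleftrightarrow> k = l \<and> y = flip x k"
    using assms by (metis flip_flip flip_inject length_flip)
  then show ?thesis using assms by (auto simp: edge_def doubleton_eq_iff flip_inject)
qed

lemma hypercube_adjacent_iff:
  "{x, y} \<in> edges (hypercube d) \<longleftrightarrow> length x = d \<and> (\<exists>k<d. y = flip x k)"
proof -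
  have *: "card {i. i < d \<and> x ! i \<noteq> y ! i} = 1 \<longleftrightarrow> (\<exists>k<d. y = flip x k)"
    if len: "length x = d" "length y = d" for x y :: "bool list"
  proof
    assume "card {i. i < d \<and> x ! i \<noteq> y ! i} = 1"
    then obtain k where k: "{i. i < d \<and> x ! i \<noteq> y ! i} = {k}" by (auto simp: card_1_singleton_iff)
    then have "k < d" by auto
    moreover have "y = flip x k"
    proof (rule nth_equalityI)
      fix l assume "l < length y"
      then show "y ! l = flip x k ! l" using len k \<open>k < d\<close> by (cases "l = k") (auto simp: nth_flip)
    qed (use len in simp)
    ultimately show "\<exists>k<d. y = flip x k" by blast
  next
    assume "\<exists>k<d. y = flip x k"
    then obtain k where "k < d" "y = flip x k" by auto
    then have "{i. i < d \<and> x ! i \<noteq> y ! i} = {k}" using len by (auto simp: nth_flip)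
    then show "card {i. i < d \<and> x ! i \<noteq> y ! i} = 1" by simp
  qed
  have "{x, y} \<in> edges (hypercube d) \<longleftrightarrow>
      length x = d \<and> length y = d \<and> card {i. i < d \<and> x ! i \<noteq> y ! i} = 1"
  proof -
    have sym: "card {i. i < d \<and> y ! i \<noteq> x ! i} = card {i. i < d \<and> x ! i \<noteq> y ! i}"
      by (rule arg_cong[where f = card]) blast
    show ?thesis
    proof
      assume "{x, y} \<in> edges (hypercube d)"
      then obtain a b where ab: "{x, y} = {a, b}" "length a = d" "length b = d"
        "card {i. i < d \<and> a ! i \<noteq> b ! i} = 1" unfolding hypercube_def by force
      from ab(1) consider "x = a" "y = b" | "x = b" "y = a" unfolding doubleton_eq_iff by blast
      then show "length x = d \<and> length y = d \<and> card {i. i < d \<and> x ! i \<noteq> y ! i} = 1"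
        using ab(2-4) sym by cases simp_all
    qed (auto simp: hypercube_def)
  qed
  then show ?thesis using * by auto
qed

lemma edges_hypercube: "edges (hypercube d) = {edge x k | x k. length x = d \<and> k < d}"
proof -
  have "\<exists>x y. e = {x, y}" if "e \<in> edges (hypercube d)" for e
    using that by (auto simp: hypercube_def)
  then show ?thesis
    by (auto simp: edge_def hypercube_adjacent_iff) (metis hypercube_adjacent_iff)
qed

lemma verts_hypercube: "verts (hypercube d) = {x. length x = d}"
  by (simp add: hypercube_def)

lemma finite_verts_hypercube: "finite {x :: bool list. length x = d}"
  using finite_lists_length_eq[of "UNIV :: bool set" d] by simp

text \<open>The hypercube is connected, phrased as an induction principle.\<close>

lemma flip_connected:
  assumes "length x = d" "length y = d" "P x"
    and step: "\<And>z k. length z = d \<Longrightarrow> k < d \<Longrightarrow> P z \<Longrightarrow> P (flip z k)"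
  shows "P y"
  using assms(1,3)
proof (induction "card {i. i < d \<and> x ! i \<noteq> y ! i}" arbitrary: x)
  case 0
  then have "x = y" using assms(2) by (auto intro: nth_equalityI)
  then show ?case using 0 by simp
next
  case (Suc n)
  then have "{i. i < d \<and> x ! i \<noteq> y ! i} \<noteq> {}" by (metis card.empty nat.distinct(1))
  then obtain k where k: "k < d" "x ! k \<noteq> y ! k" by auto
  have "{i. i < d \<and> flip x k ! i \<noteq> y ! i} = {i. i < d \<and> x ! i \<noteq> y ! i} - {k}"
    using k Suc.prems by (auto simp: nth_flip)
  then have "card {i. i < d \<and> flip x k ! i \<noteq> y ! i} = n"
    using Suc.hyps(2) k by (simp add: card_Diff_singleton)
  then show ?case using Suc.hyps(1)[of "flip x k"] Suc.prems step k by simp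
qed

text \<open>Flipping an entry changes this parity, which makes the hypercube bipartite.\<close>

definition even_vertex :: "bool list \<Rightarrow> bool" where
  "even_vertex x \<longleftrightarrow> even (card {i. i < length x \<and> x ! i})"

lemma even_vertex_flip:
  assumes "k < length x"
  shows "even_vertex (flip x k) \<longleftrightarrow> \<not> even_vertex x"
proof -
  let ?S = "\<lambda>x :: bool list. {i. i < length x \<and> x ! i}"
  have *: "card (?S (flip x k)) = Suc (card (?S x))" if "\<not> x ! k" "k < length x" for x
  proof -
    have "?S (flip x k) = insert k (?S x)" using that by (auto simp: nth_flip)
    then show ?thesis using that by simp
  qed
  show ?thesis
  proof (cases "x ! k")
    case True
    then show ?thesis using *[of "flip x k"] assms by (simp add: even_vertex_def nth_flip)
  next
    case False
    then show ?thesis using *[of x] assms by (simp add: even_vertex_def)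
  qed
qed

section \<open>Dimensional matchings are directions\<close>

text \<open>
  Any two edges at a common vertex lie on a 4-cycle. Two disjoint copies of \<open>Q\<^sub>n\<close> inherit this
  isomorphism invariant, which only the removal of a direction preserves in a cube.
\<close>

definition corners_close :: "'a graph \<Rightarrow> bool" where
  "corners_close G \<longleftrightarrow>
     (\<forall>v\<in>verts G. \<forall>a\<in>verts G. \<forall>b\<in>verts G. a \<noteq> b \<and> {v, a} \<in> edges G \<and> {v, b} \<in> edges G \<longrightarrow>
        (\<exists>w\<in>verts G. w \<noteq> v \<and> {a, w} \<in> edges G \<and> {b, w} \<in> edges G))"

lemma corners_close_hypercube: "corners_close (hypercube n)"
  unfolding corners_close_def
proof (intro ballI impI)
  fix v a b
  assume "v \<in> verts (hypercube n)"
    and ab: "a \<noteq> b \<and> {v, a} \<in> edges (hypercube n) \<and> {v, b} \<in> edges (hypercube n)"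
  then obtain k l where kl: "length v = n" "k < n" "l < n" "k \<noteq> l" "a = flip v k" "b = flip v l"
    by (auto simp: hypercube_adjacent_iff)
  have "flip (flip v k) l ! k \<noteq> v ! k" using kl by (simp add: nth_flip)
  then have "flip (flip v k) l \<noteq> v" by metis
  moreover have "{a, flip (flip v k) l} \<in> edges (hypercube n)"
    "{b, flip (flip v k) l} \<in> edges (hypercube n)"
    using kl flip_commute[of v k l] by (auto simp: hypercube_adjacent_iff)
  ultimately show "\<exists>w\<in>verts (hypercube n). w \<noteq> v \<and> {a, w} \<in> edges (hypercube n) \<and>
      {b, w} \<in> edges (hypercube n)"
    using kl by (intro bexI[of _ "flip (flip v k) l"]) (auto simp: verts_hypercube)
qed

lemma corners_close_disjoint_union:
  assumes "corners_close G" "corners_close H"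
  shows "corners_close (disjoint_union G H)"
proof -
  have separate: "{Inl a, v} \<noteq> Inr ` S" "{v, Inl a} \<noteq> Inr ` S"
    "{Inr b, w} \<noteq> Inl ` T" "{w, Inr b} \<noteq> Inl ` T" for a :: 'a and b :: 'b and v w S T
    by (metis imageE insertCI sum.distinct)+
  have injL: "inj (image (Inl :: 'a \<Rightarrow> 'a + 'b))" and injR: "inj (image (Inr :: 'b \<Rightarrow> 'a + 'b))"
    by (auto intro!: injI simp: inj_image_eq_iff)
  have Inl_edge: "{Inl a, Inl b} \<in> edges (disjoint_union G H) \<longleftrightarrow> {a, b} \<in> edges G" for a b
    using inj_image_mem_iff[OF injL, of "{a, b}" "edges G"] separate
    by (auto simp: disjoint_union_def)
  have Inr_edge: "{Inr a, Inr b} \<in> edges (disjoint_union G H) \<longleftrightarrow> {a, b} \<in> edges H" for a b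
    using inj_image_mem_iff[OF injR, of "{a, b}" "edges H"] separate
    by (auto simp: disjoint_union_def)
  have mixed: "{Inl a, Inr b} \<notin> edges (disjoint_union G H)"
    "{Inr b, Inl a} \<notin> edges (disjoint_union G H)" for a b
    using separate by (auto simp: disjoint_union_def)
  have verts: "verts (disjoint_union G H) = Inl ` verts G \<union> Inr ` verts H"
    by (simp add: disjoint_union_def)
  show ?thesis
    unfolding corners_close_def
  proof (intro ballI impI)
    fix v a b
    assume v: "v \<in> verts (disjoint_union G H)" "a \<in> verts (disjoint_union G H)" "b \<in> verts (disjoint_union G H)"
      and ab: "a \<noteq> b \<and> {v, a} \<in> edges (disjoint_union G H) \<and> {v, b} \<in> edges (disjoint_union G H)"
    show "\<exists>w\<in>verts (disjoint_union G H). w \<noteq> v \<and> {a, w} \<in> edges (disjoint_union G H) \<and>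
        {b, w} \<in> edges (disjoint_union G H)"
    proof (cases v)
      case (Inl v')
      then obtain a' b' where "a = Inl a'" "b = Inl b'" using ab mixed by (metis sumE)
      moreover then have "\<exists>w\<in>verts G. w \<noteq> v' \<and> {a', w} \<in> edges G \<and> {b', w} \<in> edges G"
        using assms(1) v ab Inl unfolding corners_close_def
        by (auto simp: verts Inl_edge)
      ultimately show ?thesis using Inl
        by (auto simp: verts Inl_edge)
    next
      case (Inr v')
      then obtain a' b' where "a = Inr a'" "b = Inr b'" using ab mixed by (metis sumE)
      moreover then have "\<exists>w\<in>verts H. w \<noteq> v' \<and> {a', w} \<in> edges H \<and> {b', w} \<in> edges H"
        using assms(2) v ab Inr unfolding corners_close_def
        by (auto simp: verts Inr_edge)
      ultimately show ?thesis using Inr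
        by (auto simp: verts Inr_edge)
    qed
  qed
qed

lemma corners_close_iso:
  assumes "graph_iso G H" "corners_close H"
  shows "corners_close G"
proof -
  obtain f where f: "bij_betw f (verts G) (verts H)"
    "\<forall>u\<in>verts G. \<forall>v\<in>verts G. {u, v} \<in> edges G \<longleftrightarrow> {f u, f v} \<in> edges H"
    using assms(1) by (auto simp: graph_iso_def)
  show ?thesis
    unfolding corners_close_def
  proof (intro ballI impI)
    fix v a b
    assume v: "v \<in> verts G" "a \<in> verts G" "b \<in> verts G"
      and ab: "a \<noteq> b \<and> {v, a} \<in> edges G \<and> {v, b} \<in> edges G"
    have "f v \<in> verts H" "f a \<in> verts H" "f b \<in> verts H" "f a \<noteq> f b"
      using f(1) v ab by (auto simp: bij_betw_def inj_on_def)
    moreover have "{f v, f a} \<in> edges H" "{f v, f b} \<in> edges H" using f(2) v ab by auto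
    ultimately obtain w where w: "w \<in> verts H" "w \<noteq> f v" "{f a, w} \<in> edges H" "{f b, w} \<in> edges H"
      using assms(2) unfolding corners_close_def by metis
    then obtain w' where "w' \<in> verts G" "w = f w'" using f(1) by (auto simp: bij_betw_def)
    then show "\<exists>w\<in>verts G. w \<noteq> v \<and> {a, w} \<in> edges G \<and> {b, w} \<in> edges G"
      using w v f(2) by (intro bexI[of _ w']) auto
  qed
qed

text \<open>
  Suppose that the edge of \<open>M\<close> at \<open>v\<close> has direction \<open>m\<close>, while the one at a neighbor
  \<open>flip v k\<close> has another direction \<open>j\<close>. Then the edges at \<open>v\<close> in the directions \<open>k\<close> and \<open>j\<close>
  survive the removal of \<open>M\<close> and so lie on a common 4-cycle avoiding \<open>M\<close>. The only
  candidate in the cube is the square spanned by \<open>k\<close> and \<open>j\<close>, but one of its sides is the edge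
  of \<open>M\<close> at \<open>flip v k\<close>. So neighbors agree, and the direction is constant by connectedness.
\<close>

lemma dimensional_matching_direction:
  assumes "dimensional_matching d M"
  obtains i where "i < d" "M \<subseteq> {edge x i | x. length x = d}"
proof -
  let ?Q = "hypercube d"
  have pm: "M \<subseteq> edges ?Q" "\<And>e e'. e \<in> M \<Longrightarrow> e' \<in> M \<Longrightarrow> e \<noteq> e' \<Longrightarrow> e \<inter> e' = {}"
    "\<Union>M = {x. length x = d}"
    using assms by (auto simp: dimensional_matching_def perfect_matching_def matching_def verts_hypercube)
  let ?H = "delete_edges ?Q M"
  have cc: "corners_close ?H"
    using assms corners_close_iso corners_close_disjoint_union corners_close_hypercube
    unfolding dimensional_matching_def by blast
  have ex: "\<exists>k<d. edge x k \<in> M" if x: "length x = d" for x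
  proof -
    obtain e where e: "e \<in> M" "x \<in> e" using pm(3) x by auto
    then obtain y k where yk: "e = edge y k" "length y = d" "k < d" using pm(1) by (auto simp: edges_hypercube)
    then have "e = edge x k" using e by (auto simp: edge_def)
    then show ?thesis using e yk by auto
  qed
  have uniq: "k = l" if "length x = d" "k < d" "l < d" "edge x k \<in> M" "edge x l \<in> M" for x k l
    using pm(2)[OF that(4,5)] that(1-3) by (auto simp: edge_def doubleton_eq_iff flip_inject)
  have step: "edge (flip v k) m \<in> M" if v: "length v = d" "m < d" "edge v m \<in> M" "k < d" for v m k
  proof (cases "k = m")
    case True
    then show ?thesis using v by (simp add: edge_flip)
  next
    case False
    obtain j where j: "j < d" "edge (flip v k) j \<in> M" using ex[of "flip v k"] v by auto
    have "edge v k \<notin> M" using uniq[of v k m] v False by auto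
    then have "j \<noteq> k" using j v by (auto simp: edge_flip)
    have "j = m"
    proof (rule ccontr)
      assume "j \<noteq> m"
      then have "edge v j \<notin> M" using uniq[of v j m] v j by auto
      then have edges: "{v, flip v k} \<in> edges ?H" "{v, flip v j} \<in> edges ?H"
        using \<open>edge v k \<notin> M\<close> v j by (auto simp: delete_edges_def edge_def hypercube_adjacent_iff)
      have verts: "v \<in> verts ?H" "flip v k \<in> verts ?H" "flip v j \<in> verts ?H"
        using v by (auto simp: delete_edges_def verts_hypercube)
      have "flip v k \<noteq> flip v j" using v j \<open>j \<noteq> k\<close> by (simp add: flip_inject)
      then obtain w where "w \<noteq> v" "{flip v k, w} \<in> edges ?H" "{flip v j, w} \<in> edges ?H"
        using cc verts edges unfolding corners_close_def by blast
      then have w: "w \<noteq> v" "{flip v k, w} \<in> edges ?Q - M" "{flip v j, w} \<in> edges ?Q - M"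
        by (auto simp: delete_edges_def)
      then obtain a b where ab: "a < d" "w = flip (flip v k) a" "b < d" "w = flip (flip v j) b"
        by (auto simp: hypercube_adjacent_iff)
      have "a \<noteq> k" using w(1) ab v by auto
      then have "flip (flip v j) b ! k \<noteq> v ! k" using ab v by (metis length_flip nth_flip)
      then have "b = k" using \<open>j \<noteq> k\<close> v j ab by (auto simp: nth_flip split: if_splits)
      then have "w = flip (flip v k) j" using ab flip_commute by auto
      then show False using w(2) j by (simp add: edge_def)
    qed
    then show ?thesis using j by simp
  qed
  define x0 where "x0 = replicate d False"
  have lo: "length x0 = d" by (simp add: x0_def)
  obtain i where i: "i < d" "edge x0 i \<in> M" using ex[OF lo] by auto
  have all: "edge x i \<in> M" if "length x = d" for x
    by (rule flip_connected[OF lo that, of "\<lambda>x. edge x i \<in> M"]) (use i step in auto)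
  have "M \<subseteq> {edge x i | x. length x = d}"
  proof
    fix e assume e: "e \<in> M"
    then obtain x k where xk: "e = edge x k" "length x = d" "k < d" using pm(1) by (auto simp: edges_hypercube)
    then have "k = i" using uniq[of x k i] all e i by auto
    then show "e \<in> {edge x i | x. length x = d}" using xk by auto
  qed
  then show ?thesis using that i by blast
qed

section \<open>Colorings of the hypercube indexed by vertex and direction\<close>

text \<open>
  Galvin's theorem for the subgraph of all edges with direction in \<open>D\<close>, which is
  \<open>card D\<close>-regular. An edge is represented by its even endpoint and its direction, and the
  direction serves as the ranking.
\<close>

lemma hypercube_list_coloring:
  assumes D: "D \<subseteq> {..<d}"
    and sym: "\<And>x k. length x = d \<Longrightarrow> k \<in> D \<Longrightarrow> L (flip x k) k = L x k"
    and lists: "\<And>x k. length x = d \<Longrightarrow> k \<in> D \<Longrightarrow> card D \<le> card (L x k)"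
  obtains G where "\<And>x k. length x = d \<Longrightarrow> k \<in> D \<Longrightarrow> G (flip x k) k = G x k"
    and "\<And>x k. length x = d \<Longrightarrow> k \<in> D \<Longrightarrow> G x k \<in> L x k"
    and "\<And>x. length x = d \<Longrightarrow> inj_on (G x) D"
proof -
  define E where "E = {x. length x = d \<and> even_vertex x} \<times> D"
  define q where "q e = flip (fst e) (snd e)" for e :: "bool list \<times> nat"
  have finD: "finite D" using D finite_subset by blast
  have "{x. length x = d \<and> even_vertex x} \<subseteq> {x. length x = d}" by auto
  then have finE: "finite E"
    unfolding E_def using finD finite_verts_hypercube[of d] finite_subset by blast
  have proper: "snd e \<noteq> snd f" if "e \<in> E" "f \<in> E" "e \<noteq> f" "fst e = fst f \<or> q e = q f" for e f
  proof
    assume eq: "snd e = snd f"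
    have "snd e < length (fst e)" "snd f < length (fst f)" using that(1,2) D by (auto simp: E_def)
    then have "fst e = fst f" using that(4) eq unfolding q_def by (metis flip_flip)
    then show False using eq that(3) by (simp add: prod_eq_iff)
  qed
  have "\<exists>g. (\<forall>e\<in>E. g e \<in> L (fst e) (snd e)) \<and>
      (\<forall>e\<in>E. \<forall>f\<in>E. e \<noteq> f \<and> (fst e = fst f \<or> q e = q f) \<longrightarrow> g e \<noteq> g f)"
    by (rule bipartite_list_edge_coloring[where D = D and c = snd, OF finE finD _ proper])
      (use lists in \<open>auto simp: E_def\<close>)
  then obtain g where g_list: "\<And>e. e \<in> E \<Longrightarrow> g e \<in> L (fst e) (snd e)"
    and g_proper: "\<And>e f. e \<in> E \<Longrightarrow> f \<in> E \<Longrightarrow> e \<noteq> f \<Longrightarrow> fst e = fst f \<or> q e = q f \<Longrightarrow> g e \<noteq> g f"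
    by metis
  define G where "G x k = g (if even_vertex x then x else flip x k, k)" for x k
  show ?thesis
  proof
    fix x :: "bool list" and k assume x: "length x = d" "k \<in> D"
    then have k: "k < length x" using D by auto
    show "G (flip x k) k = G x k" using k by (simp add: G_def even_vertex_flip)
    show "G x k \<in> L x k"
    proof (cases "even_vertex x")
      case True
      then show ?thesis using g_list[of "(x, k)"] x by (simp add: G_def E_def)
    next
      case False
      then show ?thesis
        using g_list[of "(flip x k, k)"] x k sym[of x k] by (simp add: G_def E_def even_vertex_flip)
    qed
  next
    fix x :: "bool list" assume x: "length x = d"
    show "inj_on (G x) D"
    proof (rule inj_onI, rule ccontr)
      fix k l assume kl: "k \<in> D" "l \<in> D" "G x k = G x l" "k \<noteq> l"
      then have k: "k < length x" "l < length x" using D x by auto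
      show False
      proof (cases "even_vertex x")
        case True
        then show False using g_proper[of "(x, k)" "(x, l)"] kl x by (simp add: G_def E_def)
      next
        case False
        then show False
          using g_proper[of "(flip x k, k)" "(flip x l, l)"] kl k x
          by (simp add: G_def E_def q_def even_vertex_flip)
      qed
    qed
  qed
qed

text \<open>
  An edge has one representation by a vertex and a direction for each endpoint. The symmetry of
  \<open>C\<close> makes the color independent of the choice, and injectivity at each vertex is properness.
\<close>

lemma proper_edge_coloring_of_directions:
  assumes sym: "\<And>x k. length x = d \<Longrightarrow> k < d \<Longrightarrow> C (flip x k) k = C x k"
    and range: "\<And>x k. length x = d \<Longrightarrow> k < d \<Longrightarrow> C x k \<in> {1..n}"
    and inj: "\<And>x. length x = d \<Longrightarrow> inj_on (C x) {..<d}"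
  obtains f where "proper_edge_coloring (hypercube d) n f"
    and "\<And>x k. length x = d \<Longrightarrow> k < d \<Longrightarrow> f (edge x k) = C x k"
proof -
  define f where "f e = (THE c. \<exists>x k. length x = d \<and> k < d \<and> e = edge x k \<and> c = C x k)" for e
  have f: "f (edge x k) = C x k" if "length x = d" "k < d" for x k
    unfolding f_def
    by (rule the_equality) (use that sym in \<open>auto simp: edge_eq_iff[where d = d]\<close>)
  have "f e \<noteq> f e'" if e: "e \<in> edges (hypercube d)" "e' \<in> edges (hypercube d)" "e \<noteq> e'" "e \<inter> e' \<noteq> {}" for e e'
  proof -
    obtain z where z: "z \<in> e" "z \<in> e'" using e by auto
    have "\<exists>k<d. e = edge z k \<and> length z = d" if "e \<in> edges (hypercube d)" "z \<in> e" for e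
      using that by (auto simp: edges_hypercube edge_def)
    then obtain k l where "k < d" "l < d" "e = edge z k" "e' = edge z l" "length z = d" using e z by metis
    then show ?thesis using f inj[of z] e(3) by (auto simp: inj_on_def)
  qed
  then have "proper_edge_coloring (hypercube d) n f"
    unfolding proper_edge_coloring_def using range f by (auto simp: edges_hypercube)
  then show ?thesis using that f by blast
qed

section \<open>Fibres of two directions\<close>

lemma induced_matching_not_adjacent:
  assumes "induced_matching G N" "e \<in> N" "e' \<in> N" "u \<in> e" "v \<in> e'"
    and "u = v \<or> {u, v} \<in> edges G" and "u \<in> verts G" "v \<in> verts G"
  shows "e = e'"
proof (rule ccontr)
  assume "e \<noteq> e'"
  then have ge: "edge_dist G e e' \<ge> 2" using assms by (auto simp: induced_matching_def)
  define p where "p = (if u = v then [u] else [u, v])"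
  have "path_between G u p v" using assms by (auto simp: path_between_def p_def)
  then have "edge_dist G e e' \<le> enat (length p - 1)"
    unfolding edge_dist_def using assms by (intro Inf_lower) blast
  also have "\<dots> \<le> 1" by (auto simp: p_def one_enat_def zero_enat_def)
  finally have "(2 :: enat) \<le> 1" using ge order_trans by blast
  then show False by simp
qed

text \<open>
  The fibre of \<open>x\<close> consists of all vertices that agree with \<open>x\<close> outside the directions \<open>i\<close> and
  \<open>j\<close>; it is represented by the member in which both of these entries are \<open>False\<close>.
\<close>

definition base :: "nat \<Rightarrow> nat \<Rightarrow> bool list \<Rightarrow> bool list" where
  "base i j x = x[i := False, j := False]"

lemma length_base [simp]: "length (base i j x) = length x"
  by (simp add: base_def)

lemma base_flip_fibre: "k \<in> {i, j} \<Longrightarrow> base i j (flip x k) = base i j x"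
  by (cases "i = j") (auto simp: base_def flip_def list_update_swap)

lemma base_flip: "k \<notin> {i, j} \<Longrightarrow> base i j (flip x k) = flip (base i j x) k"
  by (auto simp: base_def flip_def list_update_swap)

lemma same_fibre:
  assumes "length x = d" "length y = d" "i < d" "j < d" "base i j x = base i j y"
  shows "y \<in> {x, flip x i, flip x j, flip (flip x i) j}"
proof -
  have eq: "x ! l = y ! l" if "l < d" "l \<noteq> i" "l \<noteq> j" for l
    using arg_cong[OF assms(5), of "\<lambda>z. z ! l"] that by (simp add: base_def)
  have "y = (if x ! i = y ! i then if x ! j = y ! j then x else flip x j
             else if x ! j = y ! j \<or> i = j then flip x i else flip (flip x i) j)"
    by (rule nth_equalityI) (use assms eq in \<open>auto simp: nth_flip\<close>)
  then show ?thesis by (auto split: if_splits)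
qed

text \<open>
  In a 4-cycle every vertex lies on a given edge or is adjacent to one of its endpoints, so
  two distinct edges of one fibre would be at distance at most 1.
\<close>

lemma fibre_edge_unique:
  assumes N: "induced_matching (hypercube d) N"
    and x: "length x = d" "edge x k \<in> N" "k \<in> {i, j}"
    and y: "length y = d" "edge y l \<in> N" "l \<in> {i, j}"
    and ij: "i < d" "j < d" and base: "base i j x = base i j y"
  shows "edge x k = edge y l"
proof -
  have "\<exists>u\<in>edge x k. u = y \<or> {u, y} \<in> edges (hypercube d)"
    using same_fibre[OF x(1) y(1) ij base] x(1,3) ij
    by (auto simp: edge_def hypercube_adjacent_iff intro: flip_commute)
  then obtain u where u: "u \<in> edge x k" "u = y \<or> {u, y} \<in> edges (hypercube d)" by blast
  show ?thesis
    by (rule induced_matching_not_adjacent[OF N x(2) y(2) u(1) _ u(2)])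
      (use u x y in \<open>auto simp: edge_def verts_hypercube\<close>)
qed

section \<open>The extension\<close>

text \<open>
  The list coloring \<open>G\<close> lives on all edges outside the directions \<open>i\<close> and \<open>j\<close>, that is, on four
  copies of \<open>Q\<^sub>d\<^sub>-\<^sub>2\<close>, but only its values on the copy of representatives are used. Evaluating
  it at \<open>base i j x\<close> repeats that copy in the other three, so the two colors free at a vertex,
  \<open>\<psi>\<close> and \<open>\<chi>\<close>, are the same on a whole fibre.
\<close>

lemma two_direction_extension:
  assumes ran: "ran \<phi> \<subseteq> {1..d}" and N: "induced_matching (hypercube d) (dom \<phi>)"
    and ij: "i < d" "j < d" "i \<noteq> j"
    and dom: "\<And>e. e \<in> dom \<phi> \<Longrightarrow> \<exists>x k. length x = d \<and> k \<in> {i, j} \<and> e = edge x k"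
  shows "extendable d \<phi>"
proof -
  let ?D = "{..<d} - {i, j}"
  \<comment> \<open>The precolored edge of the fibre \<open>z\<close>, if there is one, has color \<open>a\<close> and direction \<open>m\<close>.\<close>
  define prescribed where "prescribed z a m \<longleftrightarrow> (\<forall>x k. length x = d \<longrightarrow> base i j x = z \<longrightarrow> k \<in> {i, j} \<longrightarrow>
      edge x k \<in> dom \<phi> \<longrightarrow> k = m \<and> \<phi> (edge x k) = Some a)" for z a m
  have "\<exists>a m. a \<in> {1..d} \<and> m \<in> {i, j} \<and> prescribed z a m" for z
  proof (cases "\<exists>x k. length x = d \<and> base i j x = z \<and> k \<in> {i, j} \<and> edge x k \<in> dom \<phi>")
    case True
    then obtain x k where x: "length x = d" "base i j x = z" "k \<in> {i, j}" "edge x k \<in> dom \<phi>" by blast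
    then obtain a where a: "\<phi> (edge x k) = Some a" by auto
    have kd: "k < d" using x(3) ij by auto
    have "prescribed z a k"
      unfolding prescribed_def
    proof (intro allI impI)
      fix y l assume y: "length y = d" "base i j y = z" "l \<in> {i, j}" "edge y l \<in> dom \<phi>"
      have eq: "edge y l = edge x k"
        by (rule fibre_edge_unique[OF N y(1,4,3) x(1,4,3) ij(1,2)]) (simp add: x(2) y(2))
      have "l < d" using y(3) ij by auto
      then have "l = k" using eq edge_eq_iff[OF y(1) x(1) _ kd, of l] by blast
      then show "l = k \<and> \<phi> (edge y l) = Some a" using eq a by metis
    qed
    moreover have "a \<in> {1..d}" using a ran by (auto simp: ran_def)
    ultimately show ?thesis using x(3) by blast
  next
    case False
    then have "prescribed z 1 i" unfolding prescribed_def by blast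
    moreover have "1 \<in> {1..d}" using ij by auto
    ultimately show ?thesis by blast
  qed
  then obtain \<psi> \<delta> where \<psi>\<delta>: "\<And>z. \<psi> z \<in> {1..d} \<and> \<delta> z \<in> {i, j} \<and> prescribed z (\<psi> z) (\<delta> z)"
    by metis
  then have psi: "\<And>z. \<psi> z \<in> {1..d}" and delta: "\<And>z. \<delta> z \<in> {i, j}" by blast+
  have phi: "k = \<delta> (base i j x) \<and> \<phi> (edge x k) = Some (\<psi> (base i j x))"
    if "length x = d" "k \<in> {i, j}" "edge x k \<in> dom \<phi>" for x k
    using \<psi>\<delta>[of "base i j x"] that unfolding prescribed_def by blast
  have cardD: "card ?D = d - 2" using ij by (simp add: card_Diff_subset)
  have "card ?D \<le> card ({1..d} - {\<psi> x, \<psi> (flip x k)})" for x k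
  proof -
    have "d - card {\<psi> x, \<psi> (flip x k)} \<le> card ({1..d} - {\<psi> x, \<psi> (flip x k)})"
      using diff_card_le_card_Diff[of "{\<psi> x, \<psi> (flip x k)}" "{1..d}"] by simp
    moreover have "card {\<psi> x, \<psi> (flip x k)} \<le> 2" by (simp add: card_insert_if)
    ultimately show ?thesis using cardD by linarith
  qed
  then obtain G where G: "\<And>x k. length x = d \<Longrightarrow> k \<in> ?D \<Longrightarrow> G (flip x k) k = G x k"
    "\<And>x k. length x = d \<Longrightarrow> k \<in> ?D \<Longrightarrow> G x k \<in> {1..d} - {\<psi> x, \<psi> (flip x k)}"
    "\<And>x. length x = d \<Longrightarrow> inj_on (G x) ?D"
    by (rule hypercube_list_coloring[of ?D d "\<lambda>x k. {1..d} - {\<psi> x, \<psi> (flip x k)}", rotated 2]) auto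
  \<comment> \<open>The \<open>d - 2\<close> edges of \<open>G\<close> at \<open>x\<close> and \<open>\<psi> x\<close> use up at most \<open>d - 1\<close> colors.\<close>
  have "\<exists>a. a \<in> {1..d} - insert (\<psi> x) (G x ` ?D)" for x
  proof -
    have "card (insert (\<psi> x) (G x ` ?D)) \<le> Suc (card (G x ` ?D))" by (simp add: card_insert_if)
    also have "card (G x ` ?D) \<le> d - 2" using card_image_le[of ?D "G x"] cardD by simp
    finally have "card (insert (\<psi> x) (G x ` ?D)) < card {1..d}" using ij by simp
    then have "\<not> {1..d} \<subseteq> insert (\<psi> x) (G x ` ?D)" using card_mono[of "insert (\<psi> x) (G x ` ?D)" "{1..d}"] by auto
    then show ?thesis by blast
  qed
  then obtain \<chi> where chi: "\<And>x. \<chi> x \<in> {1..d} - insert (\<psi> x) (G x ` ?D)" by metis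
  define C where "C x k = (let z = base i j x in
     if k \<notin> {i, j} then G z k else if k = \<delta> z then \<psi> z else \<chi> z)" for x k
  have C_base: "C x k = G (base i j x) k" if "k \<notin> {i, j}" for x k using that by (simp add: C_def Let_def)
  have C_fibre: "C x k = (if k = \<delta> (base i j x) then \<psi> (base i j x) else \<chi> (base i j x))" if "k \<in> {i, j}" for x k
    using that by (auto simp: C_def Let_def)
  have sym: "C (flip x k) k = C x k" if "length x = d" "k < d" for x k
    using that G(1)[of "base i j x" k] by (cases "k \<in> {i, j}") (auto simp: C_base C_fibre base_flip base_flip_fibre)
  have range: "C x k \<in> {1..d}" if "length x = d" "k < d" for x k
    using that G(2)[of "base i j x" k] psi[of "base i j x"] chi[of "base i j x"]
    by (cases "k \<in> {i, j}") (auto simp: C_base C_fibre)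
  have inj: "inj_on (C x) {..<d}" if x: "length x = d" for x
  proof -
    let ?z = "base i j x"
    have z: "length ?z = d" using x by simp
    have "\<psi> ?z \<notin> G ?z ` ?D"
    proof
      assume "\<psi> ?z \<in> G ?z ` ?D"
      then obtain l where "l \<in> ?D" "\<psi> ?z = G ?z l" by blast
      then show False using G(2)[OF z, of l] by auto
    qed
    then have new: "C x k \<notin> G ?z ` ?D" if "k \<in> {i, j}" for k
      using that chi[of ?z] by (simp add: C_fibre)
    have "inj_on (C x) ?D \<longleftrightarrow> inj_on (G ?z) ?D"
      by (rule inj_on_cong) (simp add: C_base)
    then have "inj_on (C x) ?D" using G(3)[OF z] by blast
    moreover have "inj_on (C x) {i, j}"
      using chi[of ?z] delta[of ?z] ij by (auto simp: C_fibre)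
    moreover have "C x ` ?D = G ?z ` ?D"
      by (rule image_cong) (auto simp: C_base)
    moreover have "G ?z ` ?D \<inter> C x ` {i, j} = {}"
      using new[of i] new[of j] by (simp only: image_insert image_empty Int_insert_right) simp
    moreover have "?D - {i, j} = ?D" "{i, j} - ?D = {i, j}" by blast+
    ultimately have "inj_on (C x) (?D \<union> {i, j})" by (simp only: inj_on_Un simp_thms)
    then show ?thesis by (rule inj_on_subset) auto
  qed
  obtain f where f: "proper_edge_coloring (hypercube d) d f"
    "\<And>x k. length x = d \<Longrightarrow> k < d \<Longrightarrow> f (edge x k) = C x k"
    using proper_edge_coloring_of_directions[of d C d] sym range inj by blast
  have "\<phi> e = Some (f e)" if e: "e \<in> dom \<phi>" for e
  proof -
    obtain x k where x: "length x = d" "k \<in> {i, j}" "e = edge x k" using dom[OF e] by blast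
    then have "k < d" using ij by auto
    then show ?thesis using phi[of x k] x e f(2)[of x k] by (auto simp: C_fibre)
  qed
  then show ?thesis unfolding extendable_def using f(1) by blast
qed

theorem proposition3p7:
  fixes d :: nat and \<phi> :: "bool list set \<rightharpoonup> nat"
  assumes "edge_precoloring (hypercube d) \<phi>"
    and "ran \<phi> \<subseteq> {1..d}"
    and "induced_matching (hypercube d) (dom \<phi>)"
    and "\<exists>M\<^sub>1 M\<^sub>2. dimensional_matching d M\<^sub>1 \<and> dimensional_matching d M\<^sub>2 \<and> dom \<phi> \<subseteq> M\<^sub>1 \<union> M\<^sub>2"
  shows "extendable d \<phi>"
proof -
  obtain M\<^sub>1 M\<^sub>2 where M: "dimensional_matching d M\<^sub>1" "dimensional_matching d M\<^sub>2" "dom \<phi> \<subseteq> M\<^sub>1 \<union> M\<^sub>2"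
    using assms(4) by blast
  obtain i where i: "i < d" "M\<^sub>1 \<subseteq> {edge x i | x. length x = d}"
    using dimensional_matching_direction[OF M(1)] by blast
  obtain j where j: "j < d" "M\<^sub>2 \<subseteq> {edge x j | x. length x = d}"
    using dimensional_matching_direction[OF M(2)] by blast
  have dom: "\<exists>x k. length x = d \<and> k \<in> {i, j} \<and> e = edge x k" if "e \<in> dom \<phi>" for e
    using that M(3) i(2) j(2) by blast
  show ?thesis
  proof (cases "d = 1")
    case True
    \<comment> \<open>There is no second direction, but also only one color.\<close>
    obtain f where f: "proper_edge_coloring (hypercube d) d f"
      by (rule proper_edge_coloring_of_directions[where d = d and C = "\<lambda>_ _. 1" and n = d])
        (use True that in \<open>auto simp: inj_on_def\<close>)
    have "\<phi> e = Some (f e)" if e: "e \<in> dom \<phi>" for e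
    proof -
      have "e \<in> edges (hypercube d)" using assms(1) e by (auto simp: edge_precoloring_def)
      then have "f e \<in> {1..d}" using f by (auto simp: proper_edge_coloring_def)
      moreover obtain a where a: "\<phi> e = Some a" using e by auto
      then have "a \<in> {1..d}" using assms(2) by (auto simp: ran_def)
      ultimately show ?thesis using a True by simp
    qed
    then show ?thesis unfolding extendable_def using f by blast
  next
    case False
    \<comment> \<open>Two equal matchings determine only one direction; any other one may serve as the second.\<close>
    define j' where "j' = (if i = j then if i = 0 then 1 else 0 else j)"
    have "j' < d" "i \<noteq> j'" "{i, j} \<subseteq> {i, j'}" using i(1) j(1) False by (auto simp: j'_def)
    then show ?thesis
      by (intro two_direction_extension[OF assms(2,3) i(1), of j']) (use dom in blast)+
  qed
qed

end
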